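(* Let $n \ge 2$ and $t\ge 2$ be fixed integers and let $\mathcal{A} \subseteq \mathbb{F}_{q^n}$. Let $P$ be a set of $l \le \binom{t}{2}$ pairs $\{i,j\}$ with $1 \le i<j\le t$, and consider the system of $l$ norm equations $$N(X_i + X_j) = \lambda_{ij}\quad (\{i,j\}\in P), \qquad X_i \in \mathcal{A},\ i = 1,\ldots,t.$$ Suppose that each variable appears in at most $k \le t-1$ equations, and that $|\mathcal{A}| \gg q^{n/2 + t - 1}$. Then for any $\lambda_{ij} \in \mathbb{F}_q^{*}$ the system has $$(1+o(1))\, q^{-l} |\mathcal{A}|^t$$ solutions $(X_1,\ldots,X_t)\in\mathcal{A}^t$.
   Context: $q$ is a power of an odd prime, viewed as an asymptotic parameter: $q\to\infty$, the set $\mathcal{A}$ may depend on $q$, and $o(1)$ denotes a quantity tending to $0$ as $q\to\infty$. $X \ll Y$ (equivalently $Y \gg X$) means $X = o(Y)$. $\mathbb{F}_{q^n}$ is the extension of degree $n$ of the finite field $\mathbb{F}_q$. $N = N_{\mathbb{F}_{q^n}/\mathbb{F}_q}$ is the norm map, $N(X) = \prod_{i=0}^{n-1} X^{q^i} = X^{(q^n-1)/(q-1)}$, extended by $N(0)=0$. *)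

theory Defs
  imports Complex_Main "HOL-Algebra.Embedded_Algebras" "HOL-Library.Landau_Symbols"
    "HOL-Computational_Algebra.Primes"
begin

text \<open>
  \<open>K\<close> is the field with \<open>q ^ n\<close> elements and \<open>F \<subseteq> K\<close> its subfield with \<open>q\<close> elements. Fields are
  HOL-Algebra records, since the fields vary with \<open>q\<close> and so cannot be types.
\<close>
definition finite_field_extension :: "'a ring \<Rightarrow> 'a set \<Rightarrow> nat \<Rightarrow> nat \<Rightarrow> bool" where
  "finite_field_extension K F q n \<longleftrightarrow>
     field K \<and> subfield F K \<and> finite F \<and> card F = q \<and> ring.dimension K n F (carrier K)"

definition field_norm :: "'a ring \<Rightarrow> nat \<Rightarrow> nat \<Rightarrow> 'a \<Rightarrow> 'a" where
  "field_norm K q n x = (\<Otimes>\<^bsub>K\<^esub>i\<in>{..<n}. x [^]\<^bsub>K\<^esub> (q ^ i))"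

text \<open>
  A pair \<open>{i, j}\<close> with \<open>1 \<le> i < j \<le> t\<close> is encoded as the ordered pair \<open>(i, j)\<close>.
\<close>
definition index_pairs :: "nat \<Rightarrow> (nat \<times> nat) set" where
  "index_pairs t = {(i, j). 1 \<le> i \<and> i < j \<and> j \<le> t}"

definition num_equations_containing :: "(nat \<times> nat) set \<Rightarrow> nat \<Rightarrow> nat" where
  "num_equations_containing P v = card {(i, j) \<in> P. v = i \<or> v = j}"

definition norm_system_solutions ::
  "'a ring \<Rightarrow> nat \<Rightarrow> nat \<Rightarrow> nat \<Rightarrow> (nat \<times> nat) set \<Rightarrow> (nat \<Rightarrow> nat \<Rightarrow> 'a) \<Rightarrow> 'a set
    \<Rightarrow> (nat \<Rightarrow> 'a) set" where
  "norm_system_solutions K q n t P c A =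
     {X \<in> {1..t} \<rightarrow>\<^sub>E A. \<forall>(i, j)\<in>P. field_norm K q n (X i \<oplus>\<^bsub>K\<^esub> X j) = c i j}"

lemma field_norm_zero:
  assumes "field K" "n \<ge> 1" "q \<ge> 1"
  shows "field_norm K q n \<zero>\<^bsub>K\<^esub> = \<zero>\<^bsub>K\<^esub>"
proof -
  interpret field K by fact
  obtain m where n: "n = Suc m" using assms(2) by (cases n) auto
  have "finprod K (\<lambda>i. \<zero>\<^bsub>K\<^esub> [^]\<^bsub>K\<^esub> (q ^ i)) {..<Suc m} = \<zero>\<^bsub>K\<^esub>"
    unfolding lessThan_Suc using assms(3) by (subst finprod_insert) (auto simp: nat_pow_zero)
  then show ?thesis by (simp add: field_norm_def n)
qed

lemma field_norm_eq_pow: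
  assumes "field K" "x \<in> carrier K" "q \<ge> 2"
  shows "field_norm K q n x = x [^]\<^bsub>K\<^esub> ((q ^ n - 1) div (q - 1))"
proof -
  interpret field K by fact
  have "field_norm K q n x = x [^]\<^bsub>K\<^esub> (\<Sum>i<n. q ^ i)"
    unfolding field_norm_def
    by (induction n) (use assms(2) in \<open>auto simp: lessThan_Suc nat_pow_mult finprod_insert\<close>)
  moreover have "(\<Sum>i<n. q ^ i) = (q ^ n - 1) div (q - 1)"
  proof -
    have "int ((q - 1) * (\<Sum>i<n. q ^ i)) = int (q ^ n - 1)"
      using assms(3) power_diff_1_eq[of "int q" n] by (simp add: of_nat_diff)
    then have "(q - 1) * (\<Sum>i<n. q ^ i) = q ^ n - 1" by (simp only: of_nat_eq_iff)
    then show ?thesis using assms(3) by (metis nonzero_mult_div_cancel_left diff_is_0_eq not_less_eq_eq numeral_2_eq_2 One_nat_def)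
  qed
  ultimately show ?thesis by simp
qed

end

theory Submission
  imports Defs "HOL-Algebra.Multiplicative_Group" "HOL-Analysis.L2_Norm"
begin

text \<open>
  A solution of the system is a homomorphism from the graph with vertices \<open>1, \<dots>, t\<close> and edges \<open>P\<close> into
  the set \<open>A\<close>, where an edge \<open>{i, j}\<close> must land on a pair \<open>x, y\<close> with \<open>N (x + y) = c i j\<close>. Each of these
  target graphs is pseudorandom, and the count is the one that independent edges of density
  about \<open>1 / q\<close> would give.

  Pseudorandomness means the mixing inequality \<open>norm_graph_mixing\<close>: between sets \<open>U\<close> and \<open>W\<close>
  the number of edges differs from its expectation by at most \<open>sqrt (q ^ n * card U * card W)\<close>. By Fourier
  analysis on the additive group (\<open>mixing_of_fourier_bound\<close>) it amounts to a bound \<open>sqrt (q ^ n)\<close>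
  on the Fourier coefficients of a norm fibre at nonzero frequencies. A fibre is a coset of the
  group of elements of norm one, so each coefficient is repeated as often as that group has elements,
  and Parseval's identity then gives the bound.

  The homomorphisms are counted by adding the edges one at a time (\<open>homs_asymptotic\<close>). A new edge \<open>u v\<close>
  multiplies the count by the density \<open>\<delta>\<close>, up to \<open>sqrt (q ^ n)\<close> times the geometric mean of the counts
  with \<open>u\<close> or with \<open>v\<close> deleted (\<open>homs_insert_edge_error\<close>). Deleting a vertex loses one factor \<open>card A\<close>
  and at most \<open>t - 2\<close> old edges, so the error is smaller than the main term by a factor of order
  \<open>q ^ (n / 2 + t - 1) / card A\<close>, which tends to zero by hypothesis.
\<close>

section \<open>A nontrivial additive character\<close>

lemma (in comm_group) exists_maximal_proper_subgroup:
  assumes fin: "finite (carrier G)" and nontriv: "carrier G \<noteq> {\<one>}"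
  obtains M where "subgroup M G" "M \<noteq> carrier G"
    and "\<And>H. subgroup H G \<Longrightarrow> M \<subset> H \<Longrightarrow> H = carrier G"
proof -
  let ?S = "{H. subgroup H G \<and> H \<noteq> carrier G}"
  have "?S \<subseteq> Pow (carrier G)" by (auto dest: subgroup.subset)
  then have "finite ?S" using fin by (meson finite_Pow_iff finite_subset)
  moreover have "{\<one>} \<in> ?S" using nontriv by (simp add: triv_subgroup)
  ultimately obtain M where M: "M \<in> ?S" and max: "\<forall>H\<in>?S. M \<subseteq> H \<longrightarrow> M = H"
    using finite_has_maximal[of ?S] by blast
  show thesis by (rule that[of M]) (use M max in auto)
qed

text \<open>
  Take a maximal proper subgroup \<open>M\<close>, some \<open>x \<notin> M\<close>, and the least \<open>r > 0\<close> with \<open>x ^ r \<in> M\<close>. By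
  maximality \<open>M\<close> and \<open>x\<close> generate the group, so every element is \<open>g x ^ j\<close> with \<open>g \<in> M\<close> and \<open>j\<close>
  determined modulo \<open>r\<close>; the character sends it to \<open>exp (2 \<pi> \<i> j / r)\<close>. This realises the cyclic
  quotient by \<open>M\<close> inside the circle without forming the quotient group.
\<close>
lemma (in comm_group) exists_nontrivial_character:
  assumes fin: "finite (carrier G)" and nontriv: "carrier G \<noteq> {\<one>}"
  obtains \<chi> :: "'a \<Rightarrow> complex" and x
  where "\<And>y z. y \<in> carrier G \<Longrightarrow> z \<in> carrier G \<Longrightarrow> \<chi> (y \<otimes> z) = \<chi> y * \<chi> z"
    and "\<And>y. cmod (\<chi> y) = 1" and "x \<in> carrier G" and "\<chi> x \<noteq> 1"
proof -
  obtain M where M: "subgroup M G" and M_proper: "M \<noteq> carrier G"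
    and M_max: "\<And>H. subgroup H G \<Longrightarrow> M \<subset> H \<Longrightarrow> H = carrier G"
    using exists_maximal_proper_subgroup[OF assms] by blast
  interpret M: subgroup M G by (rule M)
  obtain x where x: "x \<in> carrier G" "x \<notin> M" using M_proper M.subset by auto
  \<comment> \<open>\<open>H\<close> is the subgroup generated by \<open>M\<close> and \<open>x\<close>.\<close>
  define H where "H = {y \<in> carrier G. \<exists>j::int. y \<otimes> x [^] j \<in> M}"
  have H: "subgroup H G"
  proof (unfold_locales)
    show "H \<subseteq> carrier G" by (auto simp: H_def)
    show "\<one> \<in> H" unfolding H_def using x by (auto intro!: exI[of _ "0::int"])
  next
    fix y z assume yz: "y \<in> H" "z \<in> H"
    then obtain i j :: int where ij: "y \<otimes> x [^] i \<in> M" "z \<otimes> x [^] j \<in> M"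
      and c: "y \<in> carrier G" "z \<in> carrier G" by (auto simp: H_def)
    have "(y \<otimes> z) \<otimes> x [^] (i + j) = (y \<otimes> x [^] i) \<otimes> (z \<otimes> x [^] j)"
      using c x by (simp add: int_pow_mult[symmetric] m_ac)
    then show "y \<otimes> z \<in> H" using ij c by (auto simp: H_def intro!: exI[of _ "i + j"])
  next
    fix y assume y: "y \<in> H"
    then obtain i :: int where i: "y \<otimes> x [^] i \<in> M" and c: "y \<in> carrier G" by (auto simp: H_def)
    have "inv y \<otimes> x [^] (- i) = inv (y \<otimes> x [^] i)"
      using c x by (simp add: int_pow_neg inv_mult)
    then show "inv y \<in> H" using i c by (auto simp: H_def intro!: exI[of _ "- i"])
  qed
  have "x \<otimes> x [^] (-1::int) \<in> M" using x by (simp add: int_pow_neg)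
  then have "x \<in> H" using x(1) unfolding H_def by blast
  moreover have "M \<subseteq> H"
    using M.subset by (auto simp: H_def intro!: exI[of _ "0::int"])
  ultimately have "H = carrier G" using M_max[OF H] x by blast
  then have "\<forall>y\<in>carrier G. \<exists>j::int. y \<otimes> x [^] (- j) \<in> M"
  proof (intro ballI)
    fix y assume "y \<in> carrier G"
    then have "y \<in> H" using \<open>H = carrier G\<close> by simp
    then obtain j :: int where "y \<otimes> x [^] j \<in> M" by (auto simp: H_def)
    then show "\<exists>j::int. y \<otimes> x [^] (- j) \<in> M" by (intro exI[of _ "- j"]) simp
  qed
  \<comment> \<open>\<open>J y\<close> is some representative of the class of \<open>j\<close> modulo \<open>r\<close>.\<close>
  then obtain J :: "'a \<Rightarrow> int"
    where J: "\<And>y. y \<in> carrier G \<Longrightarrow> y \<otimes> x [^] (- J y) \<in> M" by metis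
  define r where "r = (LEAST r::nat. r > 0 \<and> x [^] r \<in> M)"
  have ex: "\<exists>r::nat. r > 0 \<and> x [^] r \<in> M"
    using fin x ord_ge_1[OF fin x(1)] by (intro exI[of _ "ord x"]) auto
  have r: "r > 0" "x [^] r \<in> M" using LeastI_ex[OF ex] by (auto simp: r_def)
  have r_dvd: "int r dvd i" if i: "x [^] i \<in> M" for i :: int
  proof -
    have "x [^] (i mod int r) = x [^] i \<otimes> (x [^] r) [^] (- (i div int r))"
      using x by (simp add: int_pow_int[symmetric] int_pow_pow int_pow_mult[symmetric]
          minus_mult_div_eq_mod[symmetric] del: int_pow_int)
    also have "\<dots> \<in> M"
      using i r int_pow_closed  subgroup_int_pow_closed[OF M] by blast
    finally have "x [^] (i mod int r) \<in> M" .
    then have "x [^] nat (i mod int r) \<in> M"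
      using r by (metis int_pow_int nat_0_le of_nat_0_less_iff pos_mod_sign)
    moreover have "nat (i mod int r) < r" using r by (simp add: nat_less_iff)
    ultimately have "nat (i mod int r) = 0"
      using not_less_Least[of "nat (i mod int r)" "\<lambda>r. r > 0 \<and> x [^] r \<in> M"]
      by (auto simp: r_def[symmetric])
    moreover have "i mod int r \<ge> 0" using r by simp
    ultimately show ?thesis by (simp add: dvd_eq_mod_eq_0)
  qed
  have "r \<noteq> 1" using r x by auto
  then have r2: "r \<ge> 2" using r by simp
  define e where "e j = cis (2 * pi * real_of_int j / real r)" for j :: int
  have e_add: "e (i + j) = e i * e j" for i j
    by (simp add: e_def cis_mult add_divide_distrib distrib_left)
  have e_dvd: "e i = 1 \<longleftrightarrow> int r dvd i" for i
  proof
    assume "int r dvd i"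
    then obtain k where "i = int r * k" by blast
    then have "2 * pi * real_of_int i / real r = 2 * pi * real_of_int k" using r by simp
    then show "e i = 1" unfolding e_def by (simp add: cis_multiple_2pi)
  next
    assume "e i = 1"
    then have "cos (2 * pi * real_of_int i / real r) = 1" 
      by (simp add: e_def complex_eq_iff)
    then obtain k :: int where "2 * pi * real_of_int i / real r = real_of_int k * 2 * pi"
      using cos_one_2pi_int by blast
    then have "real_of_int i = real_of_int (int r * k)" using r by (simp add: field_simps)
    then show "int r dvd i" by (metis dvd_triv_left of_int_eq_iff)
  qed
  \<comment> \<open>Two exponents that agree modulo \<open>M\<close> give the same value, so the choice of \<open>J\<close> is harmless.\<close>
  have e_cong: "e i = e j" if "x [^] (i - j) \<in> M" for i j
  proof -
    have "e i = e (i - j) * e j" by (simp add: e_add[symmetric])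
    then show ?thesis using e_dvd[of "i - j"] r_dvd[OF that] by simp
  qed
  show thesis
  proof (rule that[of "\<lambda>y. e (J y)" x])
    fix y z assume yz: "y \<in> carrier G" "z \<in> carrier G"
    have "x [^] (J (y \<otimes> z) - (J y + J z))
          = inv ((y \<otimes> z) \<otimes> x [^] (- J (y \<otimes> z))) \<otimes> ((y \<otimes> x [^] (- J y)) \<otimes> (z \<otimes> x [^] (- J z)))"
    proof -
      have "(y \<otimes> x [^] (- J y)) \<otimes> (z \<otimes> x [^] (- J z)) = (y \<otimes> z) \<otimes> x [^] (- (J y + J z))"
        using yz x int_pow_mult[OF x(1), of "- J y" "- J z"] by (simp add: m_ac)
      moreover have "inv ((y \<otimes> z) \<otimes> x [^] (- J (y \<otimes> z))) = inv (y \<otimes> z) \<otimes> x [^] J (y \<otimes> z)"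
        using yz x by (simp add: inv_mult int_pow_neg)
      moreover have "(inv (y \<otimes> z) \<otimes> x [^] J (y \<otimes> z)) \<otimes> ((y \<otimes> z) \<otimes> x [^] (- (J y + J z)))
            = (inv (y \<otimes> z) \<otimes> (y \<otimes> z)) \<otimes> (x [^] J (y \<otimes> z) \<otimes> x [^] (- (J y + J z)))"
        using yz x by (simp only: m_ac m_closed inv_closed int_pow_closed)
      moreover have "x [^] J (y \<otimes> z) \<otimes> x [^] (- (J y + J z)) = x [^] (J (y \<otimes> z) - (J y + J z))"
        using int_pow_mult[OF x(1), of "J (y \<otimes> z)" "- (J y + J z)"]
        by (simp only: diff_conv_add_uminus)
      ultimately show ?thesis using yz x by simp
    qed
    also have "\<dots> \<in> M" using J yz by simp
    finally show "e (J (y \<otimes> z)) = e (J y) * e (J z)"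
      using e_cong by (simp add: e_add[symmetric])
  next
    show "cmod (e (J y)) = 1" for y by (simp add: e_def)
    show "x \<in> carrier G" by fact
    have "x [^] (1 - J x) = x \<otimes> x [^] (- J x)"
      using x int_pow_mult[OF x(1), of 1 "- J x"] by simp
    then have "e 1 = e (J x)" using J[OF x(1)] e_cong by simp
    moreover have "e 1 \<noteq> 1" using r2 e_dvd by auto
    ultimately show "e (J x) \<noteq> 1" by simp
  qed
qed

section \<open>Fourier analysis on a finite field\<close>

text \<open>
  One nontrivial additive character suffices: its dilates \<open>x \<mapsto> \<psi> (a x)\<close>, indexed by the field itself,
  serve as all characters, because both orthogonality relations reduce to \<open>sum_\<psi>_mult\<close>. The element
  \<open>w\<close> witnesses that \<open>\<psi>\<close> is nontrivial.
\<close>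
locale finite_field_character = field K for K (structure) +
  fixes \<psi> :: "'a \<Rightarrow> complex" and w :: 'a
  assumes fin: "finite (carrier K)"
    and \<psi>_add: "\<And>x y. x \<in> carrier K \<Longrightarrow> y \<in> carrier K \<Longrightarrow> \<psi> (x \<oplus> y) = \<psi> x * \<psi> y"
    and norm_\<psi>: "\<And>x. cmod (\<psi> x) = 1"
    and w: "w \<in> carrier K" "\<psi> w \<noteq> 1"
begin

definition fourier :: "'a set \<Rightarrow> 'a \<Rightarrow> complex" where
  "fourier U a = (\<Sum>x\<in>U. \<psi> (a \<otimes> x))"

lemma \<psi>_zero: "\<psi> \<zero> = 1"
proof -
  have "\<psi> \<zero> = \<psi> \<zero> * \<psi> \<zero>" using \<psi>_add[of \<zero> \<zero>] by simp
  moreover have "\<psi> \<zero> \<noteq> 0" using norm_\<psi>[of \<zero>] by auto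
  ultimately show ?thesis by simp
qed

lemma \<psi>_neg: "x \<in> carrier K \<Longrightarrow> \<psi> (\<ominus> x) = cnj (\<psi> x)"
proof -
  assume x: "x \<in> carrier K"
  have "\<psi> (\<ominus> x) * \<psi> x = 1" using x \<psi>_add[of "\<ominus> x" x] by (simp add: l_neg \<psi>_zero)
  moreover have "cnj (\<psi> x) * \<psi> x = 1"
    using complex_norm_square[of "\<psi> x"] norm_\<psi>[of x] by (simp add: mult.commute)
  moreover have "\<psi> x \<noteq> 0" using norm_\<psi>[of x] by auto
  ultimately show ?thesis by (metis mult_cancel_right)
qed

text \<open>
  For \<open>x \<noteq> 0\<close>, translating \<open>a\<close> by \<open>w / x\<close> permutes the field and multiplies the sum by
  \<open>\<psi> w \<noteq> 1\<close>, so the sum vanishes.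
\<close>
lemma sum_\<psi>_mult:
  assumes x: "x \<in> carrier K"
  shows "(\<Sum>a\<in>carrier K. \<psi> (a \<otimes> x)) = (if x = \<zero> then of_nat (card (carrier K)) else 0)"
proof (cases "x = \<zero>")
  case True
  then show ?thesis by (simp add: \<psi>_zero)
next
  case False
  define b where "b = w \<otimes> inv x"
  have b: "b \<in> carrier K" "b \<otimes> x = w"
    using False x w by (auto simp: b_def m_assoc field_Units)
  have bij: "bij_betw (\<lambda>a. a \<oplus> b) (carrier K) (carrier K)"
    by (rule bij_betw_byWitness[where f' = "\<lambda>a. a \<ominus> b"])
       (use b in \<open>auto simp: minus_eq a_assoc l_neg r_neg\<close>)
  have "(\<Sum>a\<in>carrier K. \<psi> (a \<otimes> x)) = (\<Sum>a\<in>carrier K. \<psi> ((a \<oplus> b) \<otimes> x))"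
    by (rule sum.reindex_bij_betw[OF bij, symmetric])
  also have "\<dots> = (\<Sum>a\<in>carrier K. \<psi> (a \<otimes> x) * \<psi> w)"
    by (rule sum.cong) (use b x in \<open>auto simp: l_distr \<psi>_add\<close>)
  also have "\<dots> = (\<Sum>a\<in>carrier K. \<psi> (a \<otimes> x)) * \<psi> w" by (simp add: sum_distrib_right)
  finally show ?thesis using w False by simp
qed

lemma parseval:
  assumes U: "U \<subseteq> carrier K"
  shows "(\<Sum>a\<in>carrier K. (cmod (fourier U a))\<^sup>2) = real (card (carrier K)) * real (card U)"
proof -
  have finU: "finite U" using U fin finite_subset by blast
  have "complex_of_real (\<Sum>a\<in>carrier K. (cmod (fourier U a))\<^sup>2)
      = (\<Sum>a\<in>carrier K. \<Sum>x\<in>U. \<Sum>y\<in>U. \<psi> (a \<otimes> (x \<ominus> y)))"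
    unfolding of_real_sum
  proof (rule sum.cong)
    fix a assume a: "a \<in> carrier K"
    have "complex_of_real ((cmod (fourier U a))\<^sup>2) = fourier U a * cnj (fourier U a)"
      by (rule complex_norm_square)
    also have "\<dots> = (\<Sum>x\<in>U. \<Sum>y\<in>U. \<psi> (a \<otimes> x) * cnj (\<psi> (a \<otimes> y)))"
      by (simp add: fourier_def sum_product)
    also have "\<dots> = (\<Sum>x\<in>U. \<Sum>y\<in>U. \<psi> (a \<otimes> (x \<ominus> y)))"
    proof (intro sum.cong refl)
      fix x y assume "x \<in> U" "y \<in> U"
      then have c: "x \<in> carrier K" "y \<in> carrier K" using U by auto
      then have "a \<otimes> (x \<ominus> y) = a \<otimes> x \<oplus> \<ominus> (a \<otimes> y)" using a by (simp add: minus_eq r_distr r_minus)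
      then show "\<psi> (a \<otimes> x) * cnj (\<psi> (a \<otimes> y)) = \<psi> (a \<otimes> (x \<ominus> y))"
        using a c by (simp add: \<psi>_add \<psi>_neg)
    qed
    finally show "complex_of_real ((cmod (fourier U a))\<^sup>2) = (\<Sum>x\<in>U. \<Sum>y\<in>U. \<psi> (a \<otimes> (x \<ominus> y)))" .
  qed simp
  also have "\<dots> = (\<Sum>x\<in>U. \<Sum>y\<in>U. \<Sum>a\<in>carrier K. \<psi> (a \<otimes> (x \<ominus> y)))"
    by (subst sum.swap) (rule sum.cong[OF refl], rule sum.swap)
  also have "\<dots> = (\<Sum>x\<in>U. \<Sum>y\<in>U. if y = x then of_nat (card (carrier K)) else 0)"
    by (intro sum.cong refl) (use U in \<open>auto simp: sum_\<psi>_mult subset_iff\<close>)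
  also have "\<dots> = complex_of_real (real (card (carrier K)) * real (card U))"
    using finU by (simp add: sum.delta)
  finally show ?thesis by (simp only: of_real_eq_iff)
qed

text \<open>
  The indicator of \<open>s = x + y\<close> is the average of \<open>\<psi> (a (s - x - y))\<close> over \<open>a\<close>, and each such term is
  a product of three Fourier transforms.
\<close>
lemma count_sums_fourier:
  assumes "S \<subseteq> carrier K" "U \<subseteq> carrier K" "W \<subseteq> carrier K"
  shows "of_nat (card (carrier K) * card {(x, y) \<in> U \<times> W. x \<oplus> y \<in> S})
       = (\<Sum>a\<in>carrier K. fourier S a * cnj (fourier U a) * cnj (fourier W a))"
proof -
  note fins = finite_subset[OF assms(1) fin] finite_subset[OF assms(2) fin] finite_subset[OF assms(3) fin]
  have "(\<Sum>a\<in>carrier K. fourier S a * cnj (fourier U a) * cnj (fourier W a))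
      = (\<Sum>a\<in>carrier K. \<Sum>s\<in>S. \<Sum>x\<in>U. \<Sum>y\<in>W. \<psi> (a \<otimes> (s \<ominus> (x \<oplus> y))))"
  proof (rule sum.cong)
    fix a assume a: "a \<in> carrier K"
    have "fourier S a * cnj (fourier U a) * cnj (fourier W a)
        = (\<Sum>s\<in>S. \<psi> (a \<otimes> s) * cnj (fourier U a) * cnj (fourier W a))"
      by (simp only: fourier_def[of S] sum_distrib_right)
    also have "\<dots> = (\<Sum>s\<in>S. \<Sum>x\<in>U. \<psi> (a \<otimes> s) * cnj (\<psi> (a \<otimes> x)) * cnj (fourier W a))"
      by (simp only: fourier_def[of U] cnj_sum sum_distrib_right sum_distrib_left)
    also have "\<dots> = (\<Sum>s\<in>S. \<Sum>x\<in>U. \<Sum>y\<in>W. \<psi> (a \<otimes> s) * cnj (\<psi> (a \<otimes> x)) * cnj (\<psi> (a \<otimes> y)))"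
      by (simp only: fourier_def[of W] cnj_sum sum_distrib_left)
    also have "\<dots> = (\<Sum>s\<in>S. \<Sum>x\<in>U. \<Sum>y\<in>W. \<psi> (a \<otimes> (s \<ominus> (x \<oplus> y))))"
    proof (intro sum.cong refl)
      fix s x y assume "s \<in> S" "x \<in> U" "y \<in> W"
      then have c: "s \<in> carrier K" "x \<in> carrier K" "y \<in> carrier K" using assms by auto
      then have "a \<otimes> (s \<ominus> (x \<oplus> y)) = a \<otimes> s \<oplus> (\<ominus> (a \<otimes> x) \<oplus> \<ominus> (a \<otimes> y))"
        using a by (simp add: minus_eq r_distr r_minus minus_add)
      then show "\<psi> (a \<otimes> s) * cnj (\<psi> (a \<otimes> x)) * cnj (\<psi> (a \<otimes> y)) = \<psi> (a \<otimes> (s \<ominus> (x \<oplus> y)))"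
        using a c by (simp add: \<psi>_add \<psi>_neg)
    qed
    finally show "fourier S a * cnj (fourier U a) * cnj (fourier W a) =
       (\<Sum>s\<in>S. \<Sum>x\<in>U. \<Sum>y\<in>W. \<psi> (a \<otimes> (s \<ominus> (x \<oplus> y))))" .
  qed simp
  also have "\<dots> = (\<Sum>s\<in>S. \<Sum>x\<in>U. \<Sum>y\<in>W. \<Sum>a\<in>carrier K. \<psi> (a \<otimes> (s \<ominus> (x \<oplus> y))))"
    by (subst sum.swap, rule sum.cong[OF refl], subst sum.swap, rule sum.cong[OF refl], rule sum.swap)
  also have "\<dots> = (\<Sum>s\<in>S. \<Sum>x\<in>U. \<Sum>y\<in>W. if s = x \<oplus> y then of_nat (card (carrier K)) else 0)"
    by (intro sum.cong refl) (use assms in \<open>auto simp: sum_\<psi>_mult subset_iff\<close>)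
  also have "\<dots> = (\<Sum>x\<in>U. \<Sum>y\<in>W. \<Sum>s\<in>S. if s = x \<oplus> y then of_nat (card (carrier K)) else 0)"
    by (subst sum.swap, rule sum.cong[OF refl], rule sum.swap)
  also have "\<dots> = (\<Sum>x\<in>U. \<Sum>y\<in>W. if x \<oplus> y \<in> S then of_nat (card (carrier K)) else 0)"
    using fins by (simp add: sum.delta)
  also have "\<dots> = (\<Sum>p\<in>U \<times> W. if fst p \<oplus> snd p \<in> S then of_nat (card (carrier K)) else 0)"
    by (simp add: sum.cartesian_product case_prod_beta)
  also have "\<dots> = of_nat (card {p \<in> U \<times> W. fst p \<oplus> snd p \<in> S}) * of_nat (card (carrier K))"
    using fins by (simp add: sum.If_cases Int_def)
  also have "{p \<in> U \<times> W. fst p \<oplus> snd p \<in> S} = {(x, y) \<in> U \<times> W. x \<oplus> y \<in> S}" by auto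
  finally show ?thesis by (simp add: mult.commute)
qed

text \<open>
  The frequency \<open>a = 0\<close> gives the main term. At the other frequencies the transform of \<open>S\<close> is at most
  \<open>B\<close>, and Cauchy--Schwarz with Parseval controls the transforms of \<open>U\<close> and \<open>W\<close>. This is the expander
  mixing lemma for the sum graph of \<open>S\<close>.
\<close>
lemma mixing_of_fourier_bound:
  assumes sub: "S \<subseteq> carrier K" "U \<subseteq> carrier K" "W \<subseteq> carrier K"
    and bound: "\<And>a. a \<in> carrier K \<Longrightarrow> a \<noteq> \<zero> \<Longrightarrow> cmod (fourier S a) \<le> B"
    and "B \<ge> 0"
  shows "\<bar>real (card {(x, y) \<in> U \<times> W. x \<oplus> y \<in> S})
           - real (card S) / real (card (carrier K)) * real (card U) * real (card W)\<bar>
         \<le> B * sqrt (real (card U) * real (card W))"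
proof -
  let ?C = "carrier K"
  let ?e = "card {(x, y) \<in> U \<times> W. x \<oplus> y \<in> S}"
  let ?g = "\<lambda>a. fourier S a * cnj (fourier U a) * cnj (fourier W a)"
  have pos: "real (card ?C) > 0" using fin zero_closed card_gt_0_iff by fastforce
  have zero: "fourier V \<zero> = of_nat (card V)" if "V \<subseteq> ?C" for V
  proof -
    have "fourier V \<zero> = (\<Sum>x\<in>V. 1)"
      unfolding fourier_def by (rule sum.cong) (use that in \<open>auto simp: \<psi>_zero\<close>)
    then show ?thesis by simp
  qed
  have "of_nat (card ?C * ?e) = ?g \<zero> + (\<Sum>a\<in>?C - {\<zero>}. ?g a)"
    unfolding count_sums_fourier[OF sub] by (rule sum.remove) (auto simp: fin)
  also have "?g \<zero> = of_nat (card S * card U * card W)" by (simp add: zero sub)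
  finally have eq: "complex_of_real (real (card ?C * ?e) - real (card S * card U * card W))
      = (\<Sum>a\<in>?C - {\<zero>}. ?g a)" by simp
  have "\<bar>real (card ?C * ?e) - real (card S * card U * card W)\<bar> = cmod (\<Sum>a\<in>?C - {\<zero>}. ?g a)"
    unfolding eq[symmetric] norm_of_real by simp
  also have "\<dots> \<le> (\<Sum>a\<in>?C - {\<zero>}. cmod (?g a))" by (rule norm_sum)
  also have "\<dots> \<le> (\<Sum>a\<in>?C - {\<zero>}. B * (cmod (fourier U a) * cmod (fourier W a)))"
    by (rule sum_mono) (use bound in \<open>auto simp: norm_mult mult.assoc intro!: mult_right_mono\<close>)
  also have "\<dots> \<le> (\<Sum>a\<in>?C. B * (cmod (fourier U a) * cmod (fourier W a)))"
    by (rule sum_mono2) (use fin \<open>B \<ge> 0\<close> in auto)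
  also have "\<dots> = B * (\<Sum>a\<in>?C. \<bar>cmod (fourier U a)\<bar> * \<bar>cmod (fourier W a)\<bar>)"
    by (simp add: sum_distrib_left)
  also have "\<dots> \<le> B * (sqrt (real (card ?C) * real (card U)) * sqrt (real (card ?C) * real (card W)))"
    using L2_set_mult_ineq[of "\<lambda>a. cmod (fourier U a)" "\<lambda>a. cmod (fourier W a)" ?C] \<open>B \<ge> 0\<close>
    by (intro mult_left_mono) (simp_all add: L2_set_def parseval sub)
  also have "\<dots> = real (card ?C) * (B * sqrt (real (card U) * real (card W)))"
    by (simp add: real_sqrt_mult)
  finally have main: "\<bar>real (card ?C * ?e) - real (card S * card U * card W)\<bar>
      \<le> real (card ?C) * (B * sqrt (real (card U) * real (card W)))" .
  have "real (card ?C) * \<bar>real ?e - real (card S) / real (card ?C) * real (card U) * real (card W)\<bar>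
      = \<bar>real (card ?C * ?e) - real (card S * card U * card W)\<bar>"
  proof -
    have "real (card ?C) * \<bar>z\<bar> = \<bar>real (card ?C) * z\<bar>" for z using pos by (simp add: abs_mult)
    then show ?thesis using pos by (simp add: right_diff_distrib)
  qed
  with main have "real (card ?C) * \<bar>real ?e - real (card S) / real (card ?C) * real (card U) * real (card W)\<bar>
      \<le> real (card ?C) * (B * sqrt (real (card U) * real (card W)))" by (simp only:)
  then show ?thesis by (simp only: mult_le_cancel_left_pos[OF pos])
qed

end

section \<open>Pseudorandomness of the norm graph\<close>

lemma (in ring) card_of_dimension:
  assumes F: "subfield F R" and fin: "finite F" and dim: "dimension n F E"
  shows "finite E \<and> card E = card F ^ n"
  using dim F fin
proof (induction n F E rule: dimension.induct)
  case (zero_dim F)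
  then show ?case by simp
next
  case (Suc_dim v E n F)
  then have finE: "finite E" and cardE: "card E = card F ^ n" by auto
  note E = space_subgroup_props[OF Suc_dim.prems(1) Suc_dim.hyps(3)]
  note FR = subringE[OF subfieldE(1)[OF Suc_dim.prems(1)]]
  have inj: "inj_on (\<lambda>(k, u). k \<otimes> v \<oplus> u) (F \<times> E)"
  proof (rule inj_onI, clarify)
    fix k u k' u' assume mem: "k \<in> F" "u \<in> E" "k' \<in> F" "u' \<in> E"
      and eq: "k \<otimes> v \<oplus> u = k' \<otimes> v \<oplus> u'"
    have c: "k \<in> carrier R" "u \<in> carrier R" "k' \<in> carrier R" "u' \<in> carrier R" "v \<in> carrier R"
      using mem E(1) FR(1) Suc_dim.hyps(1) by auto
    have "(k \<ominus> k') \<otimes> v = (k \<otimes> v \<oplus> u) \<oplus> (\<ominus> u \<oplus> \<ominus> (k' \<otimes> v))"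
      using c by algebra
    also have "\<dots> = u' \<oplus> \<ominus> u"
      unfolding eq using c by algebra
    also have "\<dots> \<in> E" using mem E by auto
    finally have *: "(k \<ominus> k') \<otimes> v \<in> E" .
    have "k \<ominus> k' \<in> F" using mem FR by (simp add: a_minus_def)
    then have "k \<ominus> k' = \<zero>" using E(6)[of "k \<ominus> k'" v] * c Suc_dim.hyps(2) by blast
    then have "k = k'" using c by simp
    then show "k = k' \<and> u = u'" using eq c by simp
  qed
  have img: "(\<lambda>(k, u). k \<otimes> v \<oplus> u) ` (F \<times> E) = line_extension F v E"
    by (fastforce simp: line_extension_mem_iff)
  have "card (line_extension F v E) = card (F \<times> E)"
    using card_image[OF inj] by (simp only: img)
  moreover have "finite (line_extension F v E)"
    unfolding img[symmetric] using finE Suc_dim.prems(2) by blast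
  ultimately show ?case using cardE by (simp add: card_cartesian_product)
qed

locale finite_extension = field K for K :: "'a ring" (structure) +
  fixes F :: "'a set" and q n :: nat
  assumes ext: "finite_field_extension K F q n" and q2: "q \<ge> 2" and n1: "n \<ge> 1"
begin

definition fibre_size :: nat where "fibre_size = (q ^ n - 1) div (q - 1)"

definition norm_fibre :: "'a \<Rightarrow> 'a set" where
  "norm_fibre c = {x \<in> carrier K. field_norm K q n x = c}"

lemma F: "subfield F K" "finite F" "card F = q"
  using ext by (auto simp: finite_field_extension_def)

lemma finite_carrier: "finite (carrier K)" and card_carrier: "card (carrier K) = q ^ n"
  using card_of_dimension[OF F(1,2), of n "carrier K"] ext
  by (auto simp: finite_field_extension_def)

lemma fibre_size_mult: "fibre_size * (q - 1) = q ^ n - 1"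
proof -
  have "(\<Sum>i<n. q ^ i) * (q - 1) = q ^ n - 1"
  proof -
    have "int ((\<Sum>i<n. q ^ i) * (q - 1)) = int (q ^ n - 1)"
      using q2 power_diff_1_eq[of "int q" n] by (simp add: of_nat_diff)
    then show ?thesis by (simp only: of_nat_eq_iff)
  qed
  then show ?thesis unfolding fibre_size_def by (metis dvd_div_mult_self dvd_triv_right)
qed

lemma fibre_size_pos: "fibre_size > 0"
proof -
  have "q ^ 1 \<le> q ^ n" using q2 n1 by (intro power_increasing) auto
  then show ?thesis using fibre_size_mult q2 by (cases fibre_size) auto
qed

lemma field_norm_eq: "x \<in> carrier K \<Longrightarrow> field_norm K q n x = x [^] fibre_size"
  using field_norm_eq_pow[OF field_axioms _ q2] by (simp add: fibre_size_def)

lemma nonzero_pow_card: 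
  assumes "x \<in> carrier K - {\<zero>}" shows "x [^] (q ^ n - 1) = \<one>"
proof -
  interpret M: group "mult_of K" by (rule field_mult_group)
  have "order (mult_of K) = q ^ n - 1"
    using order_mult_of[OF finite_carrier] by (simp add: order_def card_carrier)
  then show ?thesis using M.pow_order_eq_1[of x] assms by (simp add: nat_pow_mult_of)
qed

lemma subfield_pow_card: 
  assumes "x \<in> F - {\<zero>}" shows "x [^] (q - 1) = \<one>"
proof -
  let ?F = "K\<lparr>carrier := F\<rparr>"
  interpret S: field ?F by (rule subfield_iff(2)[OF F(1)])
  interpret M: group "mult_of ?F" by (rule S.field_mult_group)
  have "order (mult_of ?F) = q - 1"
    using S.order_mult_of by (simp add: order_def F)
  then have "x [^]\<^bsub>?F\<^esub> (q - 1) = \<one>"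
    using M.pow_order_eq_1[of x] assms by (simp add: nat_pow_mult_of)
  then show ?thesis by (simp flip: nat_pow_consistent)
qed

text \<open>
  Both sides have \<open>q - 1\<close> elements: the inclusion is Lagrange's theorem in the unit group of \<open>F\<close>, and
  \<open>x ^ (q - 1) = 1\<close> has at most \<open>q - 1\<close> roots.
\<close>
lemma subfield_nonzero_eq: "F - {\<zero>} = {x \<in> carrier K. x [^] (q - 1) = \<one>}"
proof (rule card_seteq)
  show "finite {x \<in> carrier K. x [^] (q - 1) = \<one>}" using finite_carrier by simp
  show "F - {\<zero>} \<subseteq> {x \<in> carrier K. x [^] (q - 1) = \<one>}"
    using subfield_pow_card subfieldE(3)[OF F(1)] by auto
  have "\<zero> \<in> F" using subringE(2)[OF subfieldE(1)[OF F(1)]] .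
  then have "card (F - {\<zero>}) = q - 1" using F by simp
  then show "card {x \<in> carrier K. x [^] (q - 1) = \<one>} \<le> card (F - {\<zero>})"
    using num_roots_le_deg[OF finite_carrier, of "q - 1"] q2 by simp
qed

lemma norm_nonzero_in_subfield:
  assumes "x \<in> carrier K - {\<zero>}" shows "field_norm K q n x \<in> F - {\<zero>}"
  using assms nonzero_pow_card[of x]
  by (simp add: subfield_nonzero_eq field_norm_eq nat_pow_pow fibre_size_mult del: One_nat_def)

lemma field_norm_0: "field_norm K q n \<zero> = \<zero>"
  using field_norm_zero[OF field_axioms n1] q2 by simp

lemma nonzero_of_norm: 
  "x \<in> norm_fibre c \<Longrightarrow> c \<noteq> \<zero> \<Longrightarrow> x \<in> carrier K - {\<zero>}"
  using field_norm_0 by (auto simp: norm_fibre_def)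

lemma norm_fibre_mult:
  assumes "x \<in> norm_fibre c" "h \<in> norm_fibre b" shows "x \<otimes> h \<in> norm_fibre (c \<otimes> b)"
  using assms by (auto simp: norm_fibre_def field_norm_eq nat_pow_distrib)

text \<open>
  Dividing by one element of the fibre embeds it into the roots of \<open>x ^ fibre_size = 1\<close>.
\<close>
lemma card_norm_fibre_le:
  assumes c: "c \<in> F - {\<zero>}"
  shows "card (norm_fibre c) \<le> fibre_size"
proof (cases "norm_fibre c = {}")
  case False
  then obtain x where x: "x \<in> norm_fibre c" by auto
  have xc: "x \<in> carrier K - {\<zero>}" using nonzero_of_norm[OF x] c by simp
  then have ix: "inv x \<in> carrier K" "x \<otimes> inv x = \<one>" by (auto simp: field_Units)
  have cc: "c \<in> carrier K" using c subfieldE(3)[OF F(1)] by auto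
  let ?R = "{y \<in> carrier K. y [^] fibre_size = \<one>}"
  have "(\<lambda>y. y \<otimes> inv x) ` norm_fibre c \<subseteq> ?R"
  proof (clarify, intro conjI)
    fix y assume y: "y \<in> norm_fibre c"
    then show "y \<otimes> inv x \<in> carrier K" using ix by (simp add: norm_fibre_def)
    have "(y \<otimes> inv x) [^] fibre_size = c \<otimes> (inv x) [^] fibre_size"
      using y ix by (auto simp: norm_fibre_def field_norm_eq nat_pow_distrib)
    also have "c = x [^] fibre_size" using x by (auto simp: norm_fibre_def field_norm_eq)
    also have "\<dots> \<otimes> (inv x) [^] fibre_size = (x \<otimes> inv x) [^] fibre_size"
      using xc ix(1) by (simp add: nat_pow_distrib)
    finally show "(y \<otimes> inv x) [^] fibre_size = \<one>" using ix by simp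
  qed
  moreover have "inj_on (\<lambda>y. y \<otimes> inv x) (norm_fibre c)"
  proof (rule inj_onI)
    fix y z assume yz: "y \<in> norm_fibre c" "z \<in> norm_fibre c" "y \<otimes> inv x = z \<otimes> inv x"
    then have "y \<otimes> inv x \<otimes> x = z \<otimes> inv x \<otimes> x" by simp
    then show "y = z" using yz(1,2) xc ix m_comm[of x "inv x"] by (simp add: norm_fibre_def m_assoc)
  qed
  moreover have "finite ?R" using finite_carrier by simp
  ultimately have "card (norm_fibre c) \<le> card ?R" by (meson card_inj_on_le)
  then show ?thesis using num_roots_le_deg[OF finite_carrier, of fibre_size] fibre_size_pos by simp
qed simp

text \<open>
  The \<open>q - 1\<close> fibres over the nonzero elements of \<open>F\<close> partition the \<open>q ^ n - 1 = fibre_size * (q - 1)\<close>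
  nonzero elements of the large field. As no fibre exceeds \<open>fibre_size\<close>, all attain it.
\<close>
lemma card_norm_fibre:
  assumes c: "c \<in> F - {\<zero>}"
  shows "card (norm_fibre c) = fibre_size"
proof (rule antisym[OF card_norm_fibre_le[OF c]])
  have z: "\<zero> \<in> F" using subringE(2)[OF subfieldE(1)[OF F(1)]] .
  have "carrier K - {\<zero>} = (\<Union>b\<in>F - {\<zero>}. norm_fibre b)"
    using norm_nonzero_in_subfield nonzero_of_norm by (auto simp: norm_fibre_def)
  then have "q ^ n - 1 = card (\<Union>b\<in>F - {\<zero>}. norm_fibre b)"
    using card_carrier finite_carrier by (metis card_Diff_singleton zero_closed)
  also have "\<dots> = (\<Sum>b\<in>F - {\<zero>}. card (norm_fibre b))"
    by (rule card_UN_disjoint) (use F finite_carrier in \<open>auto simp: norm_fibre_def\<close>)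
  also have "\<dots> = card (norm_fibre c) + (\<Sum>b\<in>F - {\<zero>} - {c}. card (norm_fibre b))"
    by (rule sum.remove) (use F c in auto)
  also have "\<dots> \<le> card (norm_fibre c) + (\<Sum>b\<in>F - {\<zero>} - {c}. fibre_size)"
    by (intro add_left_mono sum_mono card_norm_fibre_le) auto
  also have "\<dots> = card (norm_fibre c) + (q - 2) * fibre_size"
    using F c z by (simp add: card_Diff_singleton numeral_2_eq_2)
  finally have "fibre_size * (q - 1) \<le> card (norm_fibre c) + (q - 2) * fibre_size"
    by (simp only: fibre_size_mult)
  moreover have "fibre_size * (q - 1) = fibre_size + (q - 2) * fibre_size"
  proof -
    have "q - 1 = Suc (q - 2)" using q2 by simp
    then show ?thesis by simp
  qed
  ultimately show "fibre_size \<le> card (norm_fibre c)" by linarith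
qed

definition fibre_density :: real where "fibre_density = real fibre_size / real (q ^ n)"

text \<open>
  The Fourier transform of a norm fibre is bounded by \<open>sqrt (q ^ n)\<close> without Gauss sums. The fibre is
  a coset of the group of elements of norm one, so its transform takes the same value at \<open>a h\<close> for
  every \<open>h\<close> of norm one. For \<open>a \<noteq> 0\<close> these points are distinct. Hence the square of that value occurs \<open>fibre_size\<close> times in the Parseval sum,
  whose total is \<open>q ^ n * fibre_size\<close>.
\<close>
lemma norm_graph_mixing:
  assumes c: "c \<in> F - {\<zero>}" and UW: "U \<subseteq> carrier K" "W \<subseteq> carrier K"
  shows "\<bar>real (card {(x, y) \<in> U \<times> W. field_norm K q n (x \<oplus> y) = c})
           - fibre_density * real (card U) * real (card W)\<bar>
         \<le> sqrt (real (q ^ n)) * sqrt (real (card U) * real (card W))"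
proof -
  interpret add: comm_group "add_monoid K" by (rule a_comm_group)
  have nontriv: "carrier K \<noteq> {\<zero>}"
    using one_not_zero one_closed by (metis singletonD)
  then obtain \<psi> :: "'a \<Rightarrow> complex" and w where
    "\<And>y z. y \<in> carrier K \<Longrightarrow> z \<in> carrier K \<Longrightarrow> \<psi> (y \<oplus> z) = \<psi> y * \<psi> z"
    "\<And>y. cmod (\<psi> y) = 1" "w \<in> carrier K" "\<psi> w \<noteq> 1"
    using add.exists_nontrivial_character[simplified, OF finite_carrier nontriv] by blast
  then interpret finite_field_character K \<psi> w
    using finite_carrier by unfold_locales auto
  let ?S = "norm_fibre c"
  have S: "?S \<subseteq> carrier K" by (auto simp: norm_fibre_def)
  have one: "\<one> \<in> F - {\<zero>}" using subringE(3)[OF subfieldE(1)[OF F(1)]] by simp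
  have cc: "c \<in> carrier K" using c subfieldE(3)[OF F(1)] by auto
  have bound: "cmod (fourier ?S a) \<le> sqrt (real (q ^ n))" if a: "a \<in> carrier K" "a \<noteq> \<zero>" for a
  proof -
    \<comment> \<open>Multiplication by an element of norm one permutes the fibre.\<close>
    have inv: "fourier ?S (a \<otimes> h) = fourier ?S a" if h: "h \<in> norm_fibre \<one>" for h
    proof -
      have hc: "h \<in> carrier K - {\<zero>}" using nonzero_of_norm[OF h] by simp
      have maps: "(\<lambda>x. h \<otimes> x) ` ?S \<subseteq> ?S"
        using norm_fibre_mult[OF h, of _ c] cc by auto
      have inj: "inj_on (\<lambda>x. h \<otimes> x) ?S"
        by (rule inj_onI) (use hc m_lcancel in \<open>simp add: norm_fibre_def\<close>)
      have "bij_betw (\<lambda>x. h \<otimes> x) ?S ?S"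
        using endo_inj_surj[OF finite_subset[OF S finite_carrier] maps inj] inj by (simp add: bij_betw_def)
      then have "fourier ?S a = (\<Sum>x\<in>?S. \<psi> (a \<otimes> (h \<otimes> x)))"
        unfolding fourier_def by (rule sum.reindex_bij_betw[symmetric])
      also have "\<dots> = fourier ?S (a \<otimes> h)"
        unfolding fourier_def by (rule sum.cong) (use S hc a in \<open>auto simp: m_assoc\<close>)
      finally show ?thesis by simp
    qed
    have "real fibre_size * (cmod (fourier ?S a))\<^sup>2 = (\<Sum>h\<in>norm_fibre \<one>. (cmod (fourier ?S (a \<otimes> h)))\<^sup>2)"
      using inv card_norm_fibre[OF one] by simp
    also have "\<dots> = (\<Sum>b\<in>(\<lambda>h. a \<otimes> h) ` norm_fibre \<one>. (cmod (fourier ?S b))\<^sup>2)"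
      by (subst sum.reindex) (use a m_lcancel in \<open>auto simp: norm_fibre_def intro!: inj_onI\<close>)
    also have "\<dots> \<le> (\<Sum>b\<in>carrier K. (cmod (fourier ?S b))\<^sup>2)"
      by (rule sum_mono2) (use a finite_carrier in \<open>auto simp: norm_fibre_def\<close>)
    also have "\<dots> = real fibre_size * real (q ^ n)"
      by (simp add: parseval[OF S] card_norm_fibre[OF c] card_carrier)
    finally have "(cmod (fourier ?S a))\<^sup>2 \<le> real (q ^ n)" using fibre_size_pos by simp
    then show ?thesis by (rule real_le_rsqrt)
  qed
  have "{(x, y) \<in> U \<times> W. field_norm K q n (x \<oplus> y) = c} = {(x, y) \<in> U \<times> W. x \<oplus> y \<in> ?S}"
    using UW by (auto simp: norm_fibre_def)
  then show ?thesis
    using mixing_of_fourier_bound[OF S UW bound]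
    by (simp add: card_norm_fibre[OF c] card_carrier fibre_density_def)
qed

text \<open>
  These bounds show that the density is asymptotic to \<open>1 / q\<close>. For \<open>n \<ge> 2\<close> the two
  differ, and the main term of the mixing inequality has to use the exact value, since \<open>q ^ n\<close> times the difference is about \<open>q ^ (n - 2)\<close>, which is beyond the error
  \<open>sqrt (q ^ n)\<close> for large \<open>n\<close>.
\<close>
lemma fibre_density_bounds:
  "1 / real q \<le> fibre_density" "fibre_density \<le> 1 / (real q - 1)"
proof -
  have *: "real fibre_size * (real q - 1) = real q ^ n - 1"
  proof -
    have "real (fibre_size * (q - 1)) = real (q ^ n - 1)" by (simp only: fibre_size_mult)
    then show ?thesis using q2 by (simp add: of_nat_diff)
  qed
  have Q: "real q ^ n > 0" "real q > 1" using q2 by auto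
  have fq: "real q ^ n \<le> real fibre_size * real q"
  proof -
    have "fibre_size \<ge> 1" using fibre_size_pos by simp
    then show ?thesis using * by (simp add: algebra_simps)
  qed
  then show "1 / real q \<le> fibre_density"
    using Q by (simp add: fibre_density_def field_simps)
  have "real fibre_size * (real q - 1) \<le> real q ^ n" using * by simp
  then show "fibre_density \<le> 1 / (real q - 1)"
    using Q by (simp add: fibre_density_def field_simps)
qed

end

section \<open>Counting homomorphisms and adding one edge\<close>

text \<open>
  Homomorphisms from the graph that \<open>E\<close> induces on \<open>V\<close>, each edge having its own target relation.
  Edges that leave \<open>V\<close> are ignored, so that deleting a vertex leaves the edge set as it is.
\<close>
definition homs :: "'b set \<Rightarrow> ('v \<Rightarrow> 'v \<Rightarrow> 'b \<Rightarrow> 'b \<Rightarrow> bool) \<Rightarrow> ('v \<times> 'v) set \<Rightarrow> 'v set \<Rightarrow> ('v \<Rightarrow> 'b) set" where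
  "homs A r E V = {X \<in> V \<rightarrow>\<^sub>E A. \<forall>(i, j)\<in>E. i \<in> V \<longrightarrow> j \<in> V \<longrightarrow> r i j (X i) (X j)}"

text \<open>
  The images of a new vertex \<open>w\<close> that extend the homomorphism \<open>Y\<close> on \<open>V\<close>.
\<close>
definition compatible :: "'b set \<Rightarrow> ('v \<Rightarrow> 'v \<Rightarrow> 'b \<Rightarrow> 'b \<Rightarrow> bool) \<Rightarrow> ('v \<times> 'v) set \<Rightarrow> 'v set \<Rightarrow> 'v \<Rightarrow> ('v \<Rightarrow> 'b) \<Rightarrow> 'b set" where
  "compatible A r E V w Y = {x \<in> A. \<forall>i\<in>V. ((i, w) \<in> E \<longrightarrow> r i w (Y i) x) \<and> ((w, i) \<in> E \<longrightarrow> r w i x (Y i))}"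

definition mixing :: "real \<Rightarrow> real \<Rightarrow> 'b set \<Rightarrow> ('b \<Rightarrow> 'b \<Rightarrow> bool) \<Rightarrow> bool" where
  "mixing \<delta> B A R \<longleftrightarrow> (\<forall>U W. U \<subseteq> A \<longrightarrow> W \<subseteq> A \<longrightarrow>
     \<bar>real (card {(x, y) \<in> U \<times> W. R x y}) - \<delta> * real (card U) * real (card W)\<bar>
       \<le> B * sqrt (real (card U) * real (card W)))"

lemma finite_homs: "finite A \<Longrightarrow> finite V \<Longrightarrow> finite (homs A r E V)"
  unfolding homs_def by (rule finite_subset[of _ "V \<rightarrow>\<^sub>E A"]) (auto intro: finite_PiE)

lemma finite_compatible: "finite A \<Longrightarrow> finite (compatible A r E V w Y)"
  unfolding compatible_def by simp

lemma bij_betw_homs_insert: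
  assumes w: "w \<notin> V" "(w, w) \<notin> E"
  shows "bij_betw (\<lambda>(Y, x). Y(w := x)) (SIGMA Y:homs A r E V. compatible A r E V w Y) (homs A r E (insert w V))"
proof (rule bij_betw_byWitness[where f' = "\<lambda>X. (restrict X V, X w)"])
  show "\<forall>p\<in>SIGMA Y:homs A r E V. compatible A r E V w Y.
      (\<lambda>X. (restrict X V, X w)) ((\<lambda>(Y, x). Y(w := x)) p) = p"
  proof
    fix p assume "p \<in> (SIGMA Y:homs A r E V. compatible A r E V w Y)"
    then obtain Y x where p: "p = (Y, x)" and Y: "Y \<in> homs A r E V" by auto
    have "restrict (Y(w := x)) V = restrict Y V" using w by (auto simp: restrict_def)
    then show "(\<lambda>X. (restrict X V, X w)) ((\<lambda>(Y, x). Y(w := x)) p) = p"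
      using Y by (auto simp: p homs_def PiE_restrict)
  qed
  show "\<forall>X\<in>homs A r E (insert w V). (\<lambda>(Y, x). Y(w := x)) (restrict X V, X w) = X"
  proof
    fix X assume "X \<in> homs A r E (insert w V)"
    then have "X \<in> extensional (insert w V)" by (auto simp: homs_def PiE_def)
    then show "(\<lambda>(Y, x). Y(w := x)) (restrict X V, X w) = X"
      by (auto simp: fun_eq_iff extensional_def)
  qed
  show "(\<lambda>(Y, x). Y(w := x)) ` (SIGMA Y:homs A r E V. compatible A r E V w Y) \<subseteq> homs A r E (insert w V)"
  proof clarify
    fix Y x assume Y: "Y \<in> homs A r E V" and x: "x \<in> compatible A r E V w Y"
    show "Y(w := x) \<in> homs A r E (insert w V)"
      unfolding homs_def
    proof (rule CollectI, intro conjI ballI)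
      show "Y(w := x) \<in> insert w V \<rightarrow>\<^sub>E A"
        using Y x by (intro PiE_fun_upd) (auto simp: homs_def compatible_def)
      fix e assume e: "e \<in> E"
      show "case e of (i, j) \<Rightarrow> i \<in> insert w V \<longrightarrow> j \<in> insert w V \<longrightarrow>
          r i j ((Y(w := x)) i) ((Y(w := x)) j)"
        using e w Y x by (cases e) (auto simp: homs_def compatible_def)
    qed
  qed
  show "(\<lambda>X. (restrict X V, X w)) ` homs A r E (insert w V) \<subseteq> (SIGMA Y:homs A r E V. compatible A r E V w Y)"
    unfolding homs_def compatible_def using w by auto
qed

lemma sum_homs_insert:
  assumes "finite A" "finite V" "w \<notin> V" "(w, w) \<notin> E"
  shows "(\<Sum>X\<in>homs A r E (insert w V). f X)
       = (\<Sum>Y\<in>homs A r E V. \<Sum>x\<in>compatible A r E V w Y. f (Y(w := x)))"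
proof -
  have "(\<Sum>X\<in>homs A r E (insert w V). f X)
      = (\<Sum>p\<in>(SIGMA Y:homs A r E V. compatible A r E V w Y). f ((\<lambda>(Y, x). Y(w := x)) p))"
    by (rule sum.reindex_bij_betw[OF bij_betw_homs_insert[OF assms(3,4)], symmetric])
  also have "\<dots> = (\<Sum>Y\<in>homs A r E V. \<Sum>x\<in>compatible A r E V w Y. f (Y(w := x)))"
    using assms by (subst sum.Sigma) (auto simp: finite_homs finite_compatible case_prod_beta)
  finally show ?thesis .
qed

lemma card_homs_insert:
  assumes "finite A" "finite V" "w \<notin> V" "(w, w) \<notin> E"
  shows "real (card (homs A r E (insert w V))) = (\<Sum>Y\<in>homs A r E V. real (card (compatible A r E V w Y)))"
  using sum_homs_insert[OF assms, where r = r and f = "\<lambda>_. 1::real"] by simp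

text \<open>
  As \<open>u\<close> and \<open>v\<close> are not adjacent, their images are chosen independently once the other vertices have
  been placed.
\<close>
lemma sum_homs_insert2:
  fixes Q :: "'b \<Rightarrow> 'b \<Rightarrow> bool"
  assumes fin: "finite A" "finite V" and uv: "u \<notin> V" "v \<notin> V" "u \<noteq> v"
    and E: "(u, u) \<notin> E" "(v, v) \<notin> E" "(u, v) \<notin> E" "(v, u) \<notin> E"
  shows "real (card {X \<in> homs A r E (insert u (insert v V)). Q (X u) (X v)})
       = (\<Sum>Y\<in>homs A r E V. real (card {(x, y) \<in> compatible A r E V u Y \<times> compatible A r E V v Y. Q x y}))"
proof -
  have finh: "finite (homs A r E (insert u (insert v V)))" using fin by (simp add: finite_homs)
  have comp: "compatible A r E (insert v V) u (Y(v := y)) = compatible A r E V u Y" for Y y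
    using uv E by (auto simp: compatible_def)
  have "real (card {X \<in> homs A r E (insert u (insert v V)). Q (X u) (X v)})
      = (\<Sum>X\<in>homs A r E (insert u (insert v V)). of_bool (Q (X u) (X v)))"
    using finh by (simp add: Int_def)
  also have "\<dots> = (\<Sum>Y\<in>homs A r E V. \<Sum>y\<in>compatible A r E V v Y. \<Sum>x\<in>compatible A r E V u Y. of_bool (Q x y))"
    using uv E fin by (simp add: sum_homs_insert comp del: sum_of_bool_eq)
  also have "\<dots> = (\<Sum>Y\<in>homs A r E V. real (card {(x, y) \<in> compatible A r E V u Y \<times> compatible A r E V v Y. Q x y}))"
  proof (rule sum.cong[OF refl])
    fix Y
    let ?U = "compatible A r E V u Y" and ?W = "compatible A r E V v Y"
    have "(\<Sum>y\<in>?W. \<Sum>x\<in>?U. of_bool (Q x y)) = (\<Sum>x\<in>?U. \<Sum>y\<in>?W. of_bool (Q x y) :: real)" by (rule sum.swap)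
    also have "\<dots> = (\<Sum>p\<in>?U \<times> ?W. of_bool (case p of (x, y) \<Rightarrow> Q x y))"
      by (simp add: sum.cartesian_product case_prod_beta del: sum_of_bool_eq)
    also have "\<dots> = real (card ((?U \<times> ?W) \<inter> {p. case p of (x, y) \<Rightarrow> Q x y}))"
      using fin by (subst sum_of_bool_eq) (auto simp: finite_compatible)
    also have "(?U \<times> ?W) \<inter> {p. case p of (x, y) \<Rightarrow> Q x y} = {(x, y) \<in> ?U \<times> ?W. Q x y}" by auto
    finally show "(\<Sum>y\<in>?W. \<Sum>x\<in>?U. of_bool (Q x y)) = real (card {(x, y) \<in> ?U \<times> ?W. Q x y})" .
  qed
  finally show ?thesis .
qed

text \<open>
  Fix the images \<open>Y\<close> of all vertices but \<open>u\<close> and \<open>v\<close>. The images of \<open>u\<close> and \<open>v\<close> then range over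
  product sets, to which the mixing inequality applies with error
  \<open>B sqrt (card (compatible u) * card (compatible v))\<close>. Summing over \<open>Y\<close>, Cauchy--Schwarz turns the
  errors into the numbers of homomorphisms with one of the two vertices deleted. A trivial bound on the
  candidate sets would lose the factors that the edges at \<open>u\<close> and \<open>v\<close> save.
\<close>
lemma homs_insert_edge_error:
  assumes fin: "finite A" "finite V" and uv: "u \<in> V" "v \<in> V" "u \<noteq> v"
    and E: "(u, u) \<notin> E" "(v, v) \<notin> E" "(u, v) \<notin> E" "(v, u) \<notin> E"
    and mix: "mixing \<delta> B A (r u v)" and B: "B \<ge> 0"
  shows "\<bar>real (card (homs A r (insert (u, v) E) V)) - \<delta> * real (card (homs A r E V))\<bar>
     \<le> B * sqrt (real (card (homs A r E (V - {v}))) * real (card (homs A r E (V - {u}))))"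
proof -
  define V0 where "V0 = V - {u, v}"
  have V: "V = insert u (insert v V0)" "V - {v} = insert u V0" "V - {u} = insert v V0"
    using uv by (auto simp: V0_def)
  have V0: "finite V0" "u \<notin> V0" "v \<notin> V0" using fin by (auto simp: V0_def)
  let ?H = "homs A r E V0"
  let ?U = "compatible A r E V0 u" and ?W = "compatible A r E V0 v"
  let ?e = "\<lambda>Y. card {(x, y) \<in> ?U Y \<times> ?W Y. r u v x y}"
  have "homs A r (insert (u, v) E) V = {X \<in> homs A r E V. r u v (X u) (X v)}"
    using uv by (auto simp: homs_def)
  then have new: "real (card (homs A r (insert (u, v) E) V)) = (\<Sum>Y\<in>?H. real (?e Y))"
    unfolding V(1) using sum_homs_insert2[OF fin(1) V0 uv(3) E, where r = r and Q = "r u v"] by simp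
  have old: "real (card (homs A r E V)) = (\<Sum>Y\<in>?H. real (card (?U Y)) * real (card (?W Y)))"
    unfolding V(1) using sum_homs_insert2[OF fin(1) V0 uv(3) E, where r = r and Q = "\<lambda>_ _. True"]
    by (simp add: card_cartesian_product)
  have "\<bar>(\<Sum>Y\<in>?H. real (?e Y)) - \<delta> * (\<Sum>Y\<in>?H. real (card (?U Y)) * real (card (?W Y)))\<bar>
      = \<bar>\<Sum>Y\<in>?H. real (?e Y) - \<delta> * real (card (?U Y)) * real (card (?W Y))\<bar>"
    by (simp add: sum_subtractf sum_distrib_left mult.assoc)
  also have "\<dots> \<le> (\<Sum>Y\<in>?H. \<bar>real (?e Y) - \<delta> * real (card (?U Y)) * real (card (?W Y))\<bar>)"
    by (rule sum_abs)
  also have "\<dots> \<le> (\<Sum>Y\<in>?H. B * sqrt (real (card (?U Y)) * real (card (?W Y))))"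
    by (rule sum_mono, rule mix[unfolded mixing_def, rule_format]) (auto simp: compatible_def)
  also have "\<dots> = B * (\<Sum>Y\<in>?H. \<bar>sqrt (real (card (?U Y)))\<bar> * \<bar>sqrt (real (card (?W Y)))\<bar>)"
    by (simp add: sum_distrib_left real_sqrt_mult)
  also have "\<dots> \<le> B * (sqrt (\<Sum>Y\<in>?H. real (card (?U Y))) * sqrt (\<Sum>Y\<in>?H. real (card (?W Y))))"
    using L2_set_mult_ineq[of "\<lambda>Y. sqrt (real (card (?U Y)))" "\<lambda>Y. sqrt (real (card (?W Y)))" ?H] B
    by (intro mult_left_mono) (simp_all add: L2_set_def)
  also have "\<dots> = B * sqrt (real (card (homs A r E (V - {v}))) * real (card (homs A r E (V - {u}))))"
    unfolding V(2,3) using card_homs_insert[OF fin(1) V0(1,2) E(1), where r = r] card_homs_insert[OF fin(1) V0(1,3) E(2), where r = r]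
    by (simp add: real_sqrt_mult)
  finally show ?thesis by (simp only: new old)
qed

section \<open>Asymptotic counts of homomorphisms\<close>

definition induced :: "('v \<times> 'v) set \<Rightarrow> 'v set \<Rightarrow> ('v \<times> 'v) set" where
  "induced E V = {(i, j) \<in> E. i \<in> V \<and> j \<in> V}"

definition incident :: "('v \<times> 'v) set \<Rightarrow> 'v \<Rightarrow> ('v \<times> 'v) set" where
  "incident E w = {(i, j) \<in> E. w = i \<or> w = j}"

lemma card_induced_remove:
  assumes "finite P" "E \<subseteq> P" "e \<in> P - E" "e \<in> incident P w" "card (incident P w) \<le> k"
  shows "card (induced E V) + 1 \<le> card (induced E (V - {w})) + k"
proof -
  have fin: "finite (incident P w)" "finite E" 
    using assms(1,2) by (auto simp: incident_def intro: finite_subset)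
  have "card (induced E V) \<le> card (induced E (V - {w}) \<union> incident E w)"
    by (rule card_mono) (use fin in \<open>auto simp: induced_def incident_def intro: finite_subset[OF _ fin(2)]\<close>)
  also have "\<dots> \<le> card (induced E (V - {w})) + card (incident E w)" by (rule card_Un_le)
  finally have "card (induced E V) \<le> card (induced E (V - {w})) + card (incident E w)" .
  moreover have "card (insert e (incident E w)) \<le> card (incident P w)"
    by (rule card_mono) (use fin assms in \<open>auto simp: incident_def\<close>)
  moreover have "card (insert e (incident E w)) = card (incident E w) + 1"
    using assms fin by (subst card_insert_disjoint) (auto simp: incident_def intro: finite_subset[OF _ fin(2)])
  ultimately show ?thesis using assms(5) by linarith
qed

text \<open>
  The edge error measured against the expected counts. Deleting a vertex of degree at most \<open>k - 1\<close> from
  the graph without the new edge multiplies the expected count by at most \<open>1 / (\<delta> ^ (k - 1) * a)\<close>, and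
  comparing with the count that includes the new edge costs one more factor \<open>1 / \<delta>\<close>. The
  geometric mean of the two deletions therefore costs \<open>1 / \<delta> ^ k\<close>, as against \<open>1 / \<delta> ^ (2 k - 1)\<close> if both vertices were
  deleted at once.
\<close>
lemma density_quotient_step:
  fixes \<delta> a B N N' Nu Nv :: real
  assumes err: "\<bar>N' - \<delta> * N\<bar> \<le> B * sqrt (Nv * Nu)" and B: "B \<ge> 0"
    and \<delta>: "0 < \<delta>" "\<delta> \<le> 1" and a: "a > 0" and s: "s \<ge> 1"
    and nonneg: "Nu \<ge> 0" "Nv \<ge> 0"
    and e: "e + 1 \<le> eu + k" "e + 1 \<le> ev + k"
  shows "\<bar>N' / (\<delta> ^ (e + 1) * a ^ s) - N / (\<delta> ^ e * a ^ s)\<bar>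
     \<le> B / (\<delta> ^ k * a) * sqrt (Nv / (\<delta> ^ ev * a ^ (s - 1)) * (Nu / (\<delta> ^ eu * a ^ (s - 1))))"
proof -
  define D where "D = \<delta> ^ (e + 1) * a ^ s"
  define g where "g i = \<delta> ^ i * a ^ (s - 1)" for i
  have D: "D > 0" and g: "\<And>i. g i > 0" using \<delta> a by (auto simp: D_def g_def)
  have as: "a ^ s = a * a ^ (s - 1)" using s by (cases s) auto
  have le: "g i * (\<delta> ^ k * a) \<le> D" if "e + 1 \<le> i + k" for i
  proof -
    have "\<delta> ^ (i + k) \<le> \<delta> ^ (e + 1)" using \<delta> that by (intro power_decreasing) auto
    then have "\<delta> ^ (i + k) * a ^ s \<le> D" using a by (simp add: D_def)
    then show ?thesis by (simp add: g_def as power_add mult_ac)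
  qed
  have "sqrt (Nv * Nu) * (\<delta> ^ k * a) \<le> D * sqrt (Nv / g ev * (Nu / g eu))"
  proof -
    have "Nv * Nu * (\<delta> ^ k * a)\<^sup>2 = (Nv / g ev * (Nu / g eu)) * ((g ev * (\<delta> ^ k * a)) * (g eu * (\<delta> ^ k * a)))"
      using g[of ev] g[of eu] by (simp add: power2_eq_square)
    also have "\<dots> \<le> (Nv / g ev * (Nu / g eu)) * (D * D)"
      using le[OF e(1)] le[OF e(2)] nonneg g[of ev] g[of eu] D \<delta> a
      by (intro mult_left_mono mult_mono) (auto intro!: mult_nonneg_nonneg divide_nonneg_nonneg less_imp_le)
    finally have "sqrt (Nv * Nu * (\<delta> ^ k * a)\<^sup>2) \<le> sqrt ((Nv / g ev * (Nu / g eu)) * D\<^sup>2)"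
      unfolding power2_eq_square by (rule real_sqrt_le_mono)
    moreover have "sqrt (x * y\<^sup>2) = sqrt x * y" if "y > 0" for x y :: real
      using that by (simp add: real_sqrt_mult)
    ultimately show ?thesis using D \<delta> a by (simp only: mult.commute[of D] zero_less_power mult_pos_pos)
  qed
  then have "sqrt (Nv * Nu) / D \<le> sqrt (Nv / g ev * (Nu / g eu)) / (\<delta> ^ k * a)"
    using D \<delta> a by (simp add: field_simps)
  then have "B * (sqrt (Nv * Nu) / D) \<le> B * (sqrt (Nv / g ev * (Nu / g eu)) / (\<delta> ^ k * a))"
    using B by (rule mult_left_mono)
  moreover have "\<bar>N' / D - N / (\<delta> ^ e * a ^ s)\<bar> = \<bar>N' - \<delta> * N\<bar> / D"
  proof -
    have "N / (\<delta> ^ e * a ^ s) = \<delta> * N / D" using \<delta> by (simp add: D_def)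
    then have "N' / D - N / (\<delta> ^ e * a ^ s) = (N' - \<delta> * N) / D" by (simp add: diff_divide_distrib)
    then show ?thesis using D by simp
  qed
  moreover have "\<bar>N' - \<delta> * N\<bar> / D \<le> B * (sqrt (Nv * Nu) / D)"
    using divide_right_mono[OF err, of D] D by simp
  ultimately show ?thesis unfolding D_def[symmetric] g_def[symmetric] by simp
qed

text \<open>
  Edges are added one at a time. Passing from \<open>E\<close> to \<open>E\<close> with the edge \<open>u v\<close>, the normalised count changes
  by at most \<open>B / (\<delta> ^ k * card A)\<close>, which tends to zero, times the geometric mean of the normalised
  counts for \<open>E\<close> on \<open>V - {u}\<close> and on \<open>V - {v}\<close>. These tend to one by induction, which is why the induction
  must treat all vertex sets at once.
\<close>
theorem homs_asymptotic:
  fixes A :: "nat \<Rightarrow> 'b set" and r :: "nat \<Rightarrow> 'v \<Rightarrow> 'v \<Rightarrow> 'b \<Rightarrow> 'b \<Rightarrow> bool"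
    and \<delta> B :: "nat \<Rightarrow> real"
  assumes finA: "\<And>m. finite (A m)" and finP: "finite P"
    and simple: "\<And>i j. (i, j) \<in> P \<Longrightarrow> i \<noteq> j \<and> (j, i) \<notin> P"
    and deg: "\<And>w. card (incident P w) \<le> k"
    and \<delta>: "\<And>m. 0 < \<delta> m" "\<And>m. \<delta> m \<le> 1" and B: "\<And>m. B m \<ge> 0"
    and mix: "\<And>m i j. (i, j) \<in> P \<Longrightarrow> mixing (\<delta> m) (B m) (A m) (r m i j)"
    and nonempty: "eventually (\<lambda>m. A m \<noteq> {}) sequentially"
    and small: "(\<lambda>m. B m / (\<delta> m ^ k * real (card (A m)))) \<longlonglongrightarrow> 0"
    and "E \<subseteq> P" and "finite V"
  shows "(\<lambda>m. real (card (homs (A m) (r m) E V))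
            / (\<delta> m ^ card (induced E V) * real (card (A m)) ^ card V)) \<longlonglongrightarrow> 1"
proof -
  define R where "R E V m = real (card (homs (A m) (r m) E V))
            / (\<delta> m ^ card (induced E V) * real (card (A m)) ^ card V)" for E V m
  have "finite E" using \<open>E \<subseteq> P\<close> finP finite_subset by blast
  then have "\<forall>V. finite V \<longrightarrow> R E V \<longlonglongrightarrow> 1"
    using \<open>E \<subseteq> P\<close>
  proof (induction E rule: finite_induct)
    case empty
    show ?case
    proof (intro allI impI)
      fix V :: "'v set" assume V: "finite V"
      have "eventually (\<lambda>m. R {} V m = 1) sequentially"
        using nonempty
      proof eventually_elim
        case (elim m)
        then have "card (A m) > 0" using finA by (simp add: card_gt_0_iff)
        moreover have "homs (A m) (r m) {} V = V \<rightarrow>\<^sub>E A m" by (simp add: homs_def)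
        ultimately show ?case using V by (simp add: R_def induced_def card_PiE)
      qed
      then show "R {} V \<longlonglongrightarrow> 1" by (rule tendsto_eventually)
    qed
  next
    case (insert e E)
    obtain u v where e: "e = (u, v)" by (cases e)
    have uvP: "(u, v) \<in> P" "E \<subseteq> P" and notin: "(u, v) \<notin> E" using insert e by auto
    have ne: "u \<noteq> v" using simple uvP by blast
    have E: "(u, u) \<notin> E" "(v, v) \<notin> E" "(v, u) \<notin> E" using simple uvP by blast+
    show ?case
    proof (intro allI impI)
      fix V :: "'v set" assume V: "finite V"
      show "R (insert e E) V \<longlonglongrightarrow> 1"
      proof (cases "u \<in> V \<and> v \<in> V")
        case False
        then have "homs (A m) (r m) (insert e E) V = homs (A m) (r m) E V" for m
          by (auto simp: homs_def e)
        moreover have "induced (insert e E) V = induced E V" using False by (auto simp: induced_def e)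
        ultimately have "R (insert e E) V = R E V" by (simp add: R_def[abs_def])
        then show ?thesis using insert V by simp
      next
        case True
        have ind: "card (induced (insert e E) V) = card (induced E V) + 1"
        proof -
          have "induced (insert e E) V = insert e (induced E V)" using True by (auto simp: induced_def e)
          moreover have "finite (induced E V)" using insert(1) by (auto simp: induced_def intro: finite_subset)
          ultimately show ?thesis using notin by (simp add: induced_def e)
        qed
        have cardV: "card V \<ge> 1" using True V by (metis One_nat_def Suc_leI card_gt_0_iff empty_iff)
        \<comment> \<open>The new edge uses up one of the \<open>k\<close> edges allowed at either end point.\<close>
        have degs: "card (induced E V) + 1 \<le> card (induced E (V - {w})) + k" if "w \<in> {u, v}" for w
          by (rule card_induced_remove[OF finP uvP(2), of "(u, v)"])
            (use that uvP notin deg in \<open>auto simp: incident_def\<close>)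
        have step: "eventually (\<lambda>m. \<bar>R (insert e E) V m - R E V m\<bar>
            \<le> B m / (\<delta> m ^ k * real (card (A m))) * sqrt (R E (V - {v}) m * R E (V - {u}) m)) sequentially"
          using nonempty
        proof eventually_elim
          case (elim m)
          then have a: "real (card (A m)) > 0" using finA by (simp add: card_gt_0_iff)
          have cards: "card (V - {v}) = card V - 1" "card (V - {u}) = card V - 1" using True V by auto
          have err: "\<bar>real (card (homs (A m) (r m) (insert (u, v) E) V)) - \<delta> m * real (card (homs (A m) (r m) E V))\<bar>
              \<le> B m * sqrt (real (card (homs (A m) (r m) E (V - {v}))) * real (card (homs (A m) (r m) E (V - {u}))))"
            using True ne E notin V
            by (intro homs_insert_edge_error finA B mix[OF uvP(1)]) auto
          show ?case
            using density_quotient_step[OF err B \<delta> a cardV _ _ degs[of u] degs[of v]]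
            by (simp add: R_def ind[unfolded e] e cards)
        qed
        have "(\<lambda>m. B m / (\<delta> m ^ k * real (card (A m))) * sqrt (R E (V - {v}) m * R E (V - {u}) m))
            \<longlonglongrightarrow> 0 * sqrt (1 * 1)"
          using insert.IH[OF uvP(2)] V by (intro tendsto_intros small) auto
        then have lim: "(\<lambda>m. B m / (\<delta> m ^ k * real (card (A m))) * sqrt (R E (V - {v}) m * R E (V - {u}) m))
            \<longlonglongrightarrow> 0" by simp
        have "(\<lambda>m. R (insert e E) V m - R E V m) \<longlonglongrightarrow> 0"
        proof (rule tendsto_0_le[OF lim, of _ 1], rule eventually_mono[OF step])
          show "norm x \<le> norm y * 1" if "\<bar>x\<bar> \<le> y" for x y :: real using that by simp
        qed
        moreover have "R E V \<longlonglongrightarrow> 1" using insert.IH[OF uvP(2)] V by blast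
        ultimately show ?thesis using tendsto_add[of "\<lambda>m. R (insert e E) V m - R E V m" 0 _ "R E V" 1] by simp
      qed
    qed
  qed
  then show ?thesis using \<open>finite V\<close> by (simp add: R_def[abs_def])
qed

section \<open>Systems of norm equations\<close>

theorem theorem2p10:
  fixes n t k l :: nat
    and P :: "(nat \<times> nat) set"
    and q :: "nat \<Rightarrow> nat"
    and K :: "nat \<Rightarrow> 'a ring"
    and F A :: "nat \<Rightarrow> 'a set"
    and c :: "nat \<Rightarrow> nat \<Rightarrow> nat \<Rightarrow> 'a"
  assumes "n \<ge> 2" and "t \<ge> 2"
    and "P \<subseteq> index_pairs t" and "card P = l" and "l \<le> t choose 2"
    and "\<forall>v\<in>{1..t}. num_equations_containing P v \<le> k" and "k \<le> t - 1"
    and "\<forall>m. \<exists>p r. Factorial_Ring.prime p \<and> odd p \<and> r > 0 \<and> q m = p ^ r"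
    and "filterlim q at_top sequentially"
    and "\<forall>m. finite_field_extension (K m) (F m) (q m) n"
    and "\<forall>m. A m \<subseteq> carrier (K m)"
    and "(\<lambda>m. real (q m) powr (real n / 2 + real t - 1)) \<in> o(\<lambda>m. real (card (A m)))"
    and "\<forall>m. \<forall>(i, j)\<in>P. c m i j \<in> F m - {\<zero>\<^bsub>K m\<^esub>}"
  shows "(\<lambda>m. real (card (norm_system_solutions (K m) (q m) n t P (c m) (A m))))
           \<sim>[sequentially] (\<lambda>m. real (card (A m)) ^ t / real (q m) ^ l)"
proof -
  have ext: "finite_extension (K m) (F m) (q m) n" for m
  proof -
    obtain p r :: nat where p: "Factorial_Ring.prime p" "r > 0" "q m = p ^ r" using assms(8) by blast
    have "p ^ 1 \<le> p ^ r" using p prime_ge_2_nat[OF p(1)] by (intro power_increasing) auto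
    then have "q m \<ge> 2" using p prime_ge_2_nat[OF p(1)] by simp
    moreover have "field (K m)" using assms(10) by (auto simp: finite_field_extension_def)
    ultimately show ?thesis
      using assms(1,10) by (simp add: finite_extension_def finite_extension_axioms_def)
  qed
  note q2 = finite_extension.q2[OF ext]
  define \<delta> where "\<delta> m = finite_extension.fibre_density (q m) n" for m
  define B where "B m = sqrt (real (q m ^ n))" for m
  define r where "r m i j x y \<longleftrightarrow> field_norm (K m) (q m) n (x \<oplus>\<^bsub>K m\<^esub> y) = c m i j" for m i j x y
  have \<delta>_lower: "1 / real (q m) \<le> \<delta> m" and \<delta>_upper: "\<delta> m \<le> 1 / (real (q m) - 1)" for m
    using finite_extension.fibre_density_bounds[OF ext] by (auto simp: \<delta>_def)
  have \<delta>: "0 < \<delta> m" "\<delta> m \<le> 1" for m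
  proof -
    have "1 / real (q m) > 0" "1 / (real (q m) - 1) \<le> 1" using q2[of m] by auto
    then show "0 < \<delta> m" "\<delta> m \<le> 1" using \<delta>_lower[of m] \<delta>_upper[of m] by linarith+
  qed
  have finA: "finite (A m)" for m
    using assms(11) finite_extension.finite_carrier[OF ext] finite_subset by blast
  have finP: "finite P" 
    using assms(3) by (rule finite_subset) (rule finite_subset[of _ "{1..t} \<times> {1..t}"], auto simp: index_pairs_def)
  have simple: "i \<noteq> j \<and> (j, i) \<notin> P" if "(i, j) \<in> P" for i j
    using subsetD[OF assms(3) that] subsetD[OF assms(3), of "(j, i)"] by (auto simp: index_pairs_def)
  have deg: "card (incident P w) \<le> t - 1" for w
  proof (cases "w \<in> {1..t}")
    case True
    then have "card (incident P w) \<le> k"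
      using assms(6) by (simp add: num_equations_containing_def incident_def)
    then show ?thesis using assms(7) by simp
  next
    case False
    then have "incident P w = {}" using assms(3) by (auto simp: incident_def index_pairs_def)
    then show ?thesis by simp
  qed
  have mix: "mixing (\<delta> m) (B m) (A m) (r m i j)" if "(i, j) \<in> P" for m i j
    unfolding mixing_def r_def \<delta>_def B_def
  proof (intro allI impI)
    fix U W assume "U \<subseteq> A m" "W \<subseteq> A m"
    moreover have "c m i j \<in> F m - {\<zero>\<^bsub>K m\<^esub>}" using assms(13) that by blast
    ultimately show "\<bar>real (card {(x, y) \<in> U \<times> W. field_norm (K m) (q m) n (x \<oplus>\<^bsub>K m\<^esub> y) = c m i j})
        - finite_extension.fibre_density (q m) n * real (card U) * real (card W)\<bar>
        \<le> sqrt (real (q m ^ n)) * sqrt (real (card U) * real (card W))"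
      using assms(11) by (intro finite_extension.norm_graph_mixing[OF ext]) blast+
  qed
  have nonempty: "eventually (\<lambda>m. A m \<noteq> {}) sequentially"
    using landau_o.smallD[OF assms(12), of 1, simplified]
  proof eventually_elim
    case (elim m)
    then show ?case using q2[of m] by auto
  qed
  have small: "(\<lambda>m. B m / (\<delta> m ^ (t - 1) * real (card (A m)))) \<longlonglongrightarrow> 0"
  proof (rule tendsto_0_le[where K = 1])
    show "(\<lambda>m. real (q m) powr (real n / 2 + real t - 1) / real (card (A m))) \<longlonglongrightarrow> 0"
      by (rule smalloD_tendsto[OF assms(12)])
    show "eventually (\<lambda>m. norm (B m / (\<delta> m ^ (t - 1) * real (card (A m))))
        \<le> norm (real (q m) powr (real n / 2 + real t - 1) / real (card (A m))) * 1) sequentially"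
      using nonempty
    proof eventually_elim
      case (elim m)
      then have a: "real (card (A m)) > 0" using finA by (simp add: card_gt_0_iff)
      have Q: "real (q m) > 0" using q2[of m] by simp
      have "B m = real (q m) powr (real n / 2)"
        using Q by (simp add: B_def powr_half_sqrt[symmetric] powr_realpow[symmetric] powr_powr)
      moreover have "real (q m) powr (real t - 1) = real (q m) ^ (t - 1)"
        using Q assms(2) powr_realpow[of "real (q m)" "t - 1"] by (simp add: of_nat_diff)
      ultimately have eq: "real (q m) powr (real n / 2 + real t - 1) = B m * real (q m) ^ (t - 1)"
        by (simp only: add_diff_eq[symmetric] powr_add)
      \<comment> \<open>The density is at least \<open>1 / q\<close>, so its inverse power is absorbed by \<open>q ^ (t - 1)\<close>.\<close>
      have "(1 / real (q m)) ^ (t - 1) \<le> \<delta> m ^ (t - 1)"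
        using \<delta>_lower Q by (intro power_mono) auto
      then have "1 / \<delta> m ^ (t - 1) \<le> real (q m) ^ (t - 1)"
        using Q \<delta>(1)[of m] by (simp add: power_divide field_simps)
      then have "(B m / real (card (A m))) * (1 / \<delta> m ^ (t - 1)) \<le> (B m / real (card (A m))) * real (q m) ^ (t - 1)"
        using a by (intro mult_left_mono) (auto simp: B_def)
      then show ?case unfolding eq using a \<delta>(1)[of m] by (simp add: B_def mult.commute abs_mult)
    qed
  qed
  have "(\<lambda>m. real (card (homs (A m) (r m) P {1..t}))
            / (\<delta> m ^ card (induced P {1..t}) * real (card (A m)) ^ card {1..t})) \<longlonglongrightarrow> 1"
    by (rule homs_asymptotic[OF finA finP simple deg \<delta> _ mix nonempty small]) (auto simp: B_def)
  moreover have "homs (A m) (r m) P {1..t} = norm_system_solutions (K m) (q m) n t P (c m) (A m)" for m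
    using assms(3) by (fastforce simp: homs_def norm_system_solutions_def r_def index_pairs_def)
  moreover have "induced P {1..t} = P"
    using assms(3) by (auto simp: induced_def index_pairs_def)
  ultimately have main: "(\<lambda>m. real (card (norm_system_solutions (K m) (q m) n t P (c m) (A m)))
            / (\<delta> m ^ l * real (card (A m)) ^ t)) \<longlonglongrightarrow> 1"
    using assms(4) by simp
  \<comment> \<open>There are a fixed number \<open>l\<close> of edges, so the exact density may be replaced by \<open>1 / q\<close>.\<close>
  have "(\<lambda>m. \<delta> m * real (q m)) \<longlonglongrightarrow> 1"
  proof (rule tendsto_sandwich)
    show "eventually (\<lambda>m. 1 \<le> \<delta> m * real (q m)) sequentially"
    proof (intro always_eventually allI)
      show "1 \<le> \<delta> m * real (q m)" for m
        using \<delta>_lower[of m] q2[of m] by (simp add: field_simps)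
    qed
    show "eventually (\<lambda>m. \<delta> m * real (q m) \<le> 1 + 1 / (real (q m) - 1)) sequentially"
    proof (intro always_eventually allI)
      fix m
      have "\<delta> m * real (q m) \<le> 1 / (real (q m) - 1) * real (q m)"
        using \<delta>_upper by (intro mult_right_mono) auto
      also have "\<dots> = 1 + 1 / (real (q m) - 1)" using q2[of m] by (simp add: field_simps)
      finally show "\<delta> m * real (q m) \<le> 1 + 1 / (real (q m) - 1)" .
    qed
    have "filterlim (\<lambda>m. real (q m)) at_top sequentially"
      using filterlim_compose[OF filterlim_real_sequentially assms(9)] .
    then have "filterlim (\<lambda>m. -1 + real (q m)) at_top sequentially"
      by (intro filterlim_tendsto_add_at_top[OF tendsto_const])
    then have "(\<lambda>m. 1 / (-1 + real (q m))) \<longlonglongrightarrow> 0"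
      by (intro real_tendsto_divide_at_top[OF tendsto_const])
    then show "(\<lambda>m. 1 + 1 / (real (q m) - 1)) \<longlonglongrightarrow> 1"
      using tendsto_add[OF tendsto_const[of "1::real"]] by (fastforce simp: algebra_simps)
  qed simp
  from tendsto_mult[OF main tendsto_power[OF this, of l]]
  have lim: "(\<lambda>m. real (card (norm_system_solutions (K m) (q m) n t P (c m) (A m)))
      / (\<delta> m ^ l * real (card (A m)) ^ t) * (\<delta> m * real (q m)) ^ l) \<longlonglongrightarrow> 1" by simp
  have "(\<lambda>m. real (card (norm_system_solutions (K m) (q m) n t P (c m) (A m)))
      / (real (card (A m)) ^ t / real (q m) ^ l)) \<longlonglongrightarrow> 1"
  proof (rule Lim_transform_eventually[OF lim], intro always_eventually allI)
    fix m
    show "real (card (norm_system_solutions (K m) (q m) n t P (c m) (A m)))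
      / (\<delta> m ^ l * real (card (A m)) ^ t) * (\<delta> m * real (q m)) ^ l
      = real (card (norm_system_solutions (K m) (q m) n t P (c m) (A m)))
      / (real (card (A m)) ^ t / real (q m) ^ l)"
      using \<delta>(1)[of m] by (simp add: power_mult_distrib)
  qed
  then show ?thesis by (rule asymp_equivI')
qed

end
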